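(* Let $X$ be a normed (respectively Banach) algebra over $K$ ($K=\mathbb{R}$ or $\mathbb{C}$). For maps $F_1,F_2:X\to X$ define $$(F_1*F_2)(x)=\frac{F_1(x)F_2(x)}{\|x\|_X}\quad(x\ne0,\ x\in X),\qquad (F_1*F_2)(0)=F_1(0)F_2(0).$$ Then $B(X)$, with the multiplication $*$, is a normed (respectively Banach) algebra. If $X$ has a unit, then $B(X)$ is a normed (respectively Banach) algebra with a unit $e$.
   Context: $B(X)$ is the set of all (possibly nonlinear) maps $F:X\to X$ with $\|F\|_{B(X)}:=\max\left(\sup_{x\ne0}\|F(x)\|_X/\|x\|_X,\ \|F(0)\|_X\right)<\infty$, with pointwise addition and scalar multiplication and the norm $\|\cdot\|_{B(X)}$. Normed spaces are assumed nontrivial. *)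

theory Defs
  imports "HOL-Analysis.Analysis" "HOL-Algebra.Algebraic_Closure_Type"
begin

text \<open>
  The scalar field \<open>K\<close> is a type \<open>'k\<close> of class \<open>real_normed_field\<close>, which covers both
  \<open>real\<close> and \<open>complex\<close>; it enters the algebraic library as the ring
  \<open>ring_of_type_algebra\<close> on the whole type.

  The library's module record also carries a field \<open>one\<close>. Algebras here need not be unital,
  and \<open>normed_algebra\<close> says nothing about that field; having a unit is expressed by the
  existence of some \<open>u\<close> with \<open>algebra_unit A u\<close>.
\<close>

record ('k, 'a) normed_algebra = "('k, 'a) module" +
  vnorm :: "'a \<Rightarrow> real"

locale normed_algebra = module "ring_of_type_algebra :: 'k::real_normed_field ring" A
  for A :: "('k::real_normed_field, 'a) normed_algebra" (structure) +
  assumes nontrivial: "carrier A \<noteq> {\<zero>}"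
    and mult_closed: "\<lbrakk>x \<in> carrier A; y \<in> carrier A\<rbrakk> \<Longrightarrow> x \<otimes> y \<in> carrier A"
    and mult_assoc: "\<lbrakk>x \<in> carrier A; y \<in> carrier A; z \<in> carrier A\<rbrakk>
      \<Longrightarrow> (x \<otimes> y) \<otimes> z = x \<otimes> (y \<otimes> z)"
    and mult_l_distr: "\<lbrakk>x \<in> carrier A; y \<in> carrier A; z \<in> carrier A\<rbrakk>
      \<Longrightarrow> (x \<oplus> y) \<otimes> z = x \<otimes> z \<oplus> y \<otimes> z"
    and mult_r_distr: "\<lbrakk>x \<in> carrier A; y \<in> carrier A; z \<in> carrier A\<rbrakk>
      \<Longrightarrow> x \<otimes> (y \<oplus> z) = x \<otimes> y \<oplus> x \<otimes> z"
    and mult_smult_left: "\<lbrakk>x \<in> carrier A; y \<in> carrier A\<rbrakk> \<Longrightarrow> (c \<odot> x) \<otimes> y = c \<odot> (x \<otimes> y)"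
    and mult_smult_right: "\<lbrakk>x \<in> carrier A; y \<in> carrier A\<rbrakk> \<Longrightarrow> x \<otimes> (c \<odot> y) = c \<odot> (x \<otimes> y)"
    and norm_nonneg: "x \<in> carrier A \<Longrightarrow> 0 \<le> vnorm A x"
    and norm_eq_zero: "x \<in> carrier A \<Longrightarrow> vnorm A x = 0 \<longleftrightarrow> x = \<zero>"
    and norm_smult: "x \<in> carrier A \<Longrightarrow> vnorm A (c \<odot> x) = norm c * vnorm A x"
    and norm_triangle: "\<lbrakk>x \<in> carrier A; y \<in> carrier A\<rbrakk>
      \<Longrightarrow> vnorm A (x \<oplus> y) \<le> vnorm A x + vnorm A y"
    and norm_mult: "\<lbrakk>x \<in> carrier A; y \<in> carrier A\<rbrakk>
      \<Longrightarrow> vnorm A (x \<otimes> y) \<le> vnorm A x * vnorm A y"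

text \<open>
  The value \<open>0\<close> off the carrier is needed because \<open>Metric_space\<close> demands nonnegativity and
  symmetry of the distance on the whole type.
\<close>

definition norm_dist :: "('k, 'a) normed_algebra \<Rightarrow> 'a \<Rightarrow> 'a \<Rightarrow> real" where
  "norm_dist A x y =
     (if x \<in> carrier A \<and> y \<in> carrier A then vnorm A (x \<ominus>\<^bsub>A\<^esub> y) else 0)"

locale banach_algebra = normed_algebra +
  assumes complete: "Metric_space.mcomplete (carrier A) (norm_dist A)"

definition algebra_unit :: "('k, 'a) normed_algebra \<Rightarrow> 'a \<Rightarrow> bool" where
  "algebra_unit A u \<longleftrightarrow>
     u \<in> carrier A \<and> (\<forall>x \<in> carrier A. u \<otimes>\<^bsub>A\<^esub> x = x \<and> x \<otimes>\<^bsub>A\<^esub> u = x)"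

definition quotients :: "('k, 'a) normed_algebra \<Rightarrow> ('a \<Rightarrow> 'a) \<Rightarrow> real set" where
  "quotients A F = (\<lambda>x. vnorm A (F x) / vnorm A x) ` (carrier A - {\<zero>\<^bsub>A\<^esub>})"

text \<open>
  Maps \<open>A \<rightarrow> A\<close> are extensional functions on \<open>carrier A\<close>, so that equality of maps is equality
  of functions. As \<open>Sup\<close> on the reals is meaningless for unbounded sets, finiteness of
  \<open>\<parallel>F\<parallel>\<close> is expressed by \<open>bdd_above\<close>. The field \<open>one\<close> is a unit whenever that of \<open>A\<close> is.
\<close>

definition bounded_maps ::
    "('k::real_normed_field, 'a) normed_algebra \<Rightarrow> ('k, 'a \<Rightarrow> 'a) normed_algebra" where
  "bounded_maps A = \<lparr>
     carrier = {F \<in> carrier A \<rightarrow>\<^sub>E carrier A. bdd_above (quotients A F)},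
     monoid.mult = (\<lambda>F G. \<lambda>x\<in>carrier A.
       if x = \<zero>\<^bsub>A\<^esub> then F \<zero>\<^bsub>A\<^esub> \<otimes>\<^bsub>A\<^esub> G \<zero>\<^bsub>A\<^esub>
       else of_real (1 / vnorm A x) \<odot>\<^bsub>A\<^esub> (F x \<otimes>\<^bsub>A\<^esub> G x)),
     one = (\<lambda>x\<in>carrier A. if x = \<zero>\<^bsub>A\<^esub> then \<one>\<^bsub>A\<^esub> else of_real (vnorm A x) \<odot>\<^bsub>A\<^esub> \<one>\<^bsub>A\<^esub>),
     ring.zero = (\<lambda>x\<in>carrier A. \<zero>\<^bsub>A\<^esub>),
     add = (\<lambda>F G. \<lambda>x\<in>carrier A. F x \<oplus>\<^bsub>A\<^esub> G x),
     smult = (\<lambda>c F. \<lambda>x\<in>carrier A. c \<odot>\<^bsub>A\<^esub> F x),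
     vnorm = (\<lambda>F. max (Sup (quotients A F)) (vnorm A (F \<zero>\<^bsub>A\<^esub>)))\<rparr>"

end

theory Submission
  imports Defs
begin

text \<open>
  With the weight \<open>w(x) = \<parallel>x\<parallel>\<close> for \<open>x \<noteq> 0\<close> and \<open>w(0) = 1\<close>, the case distinctions at \<open>0\<close> disappear:
  \<open>\<parallel>F\<parallel>\<close> is the least \<open>b\<close> with \<open>\<parallel>F(x)\<parallel> \<le> b w(x)\<close> for all \<open>x\<close>, the product is
  \<open>(F * G)(x) = w(x)\<^sup>-\<^sup>1 F(x) G(x)\<close>, and the unit is \<open>e(x) = w(x) u\<close>. The axioms are then checked
  pointwise, and completeness is that of a space of functions under a weighted supremum norm.
\<close>

context normed_algebra
begin

section \<open>Scalar arithmetic and the metric of a normed algebra\<close>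

text \<open>The inherited module laws speak of the scalars through the record
  \<open>ring_of_type_algebra\<close>. This and the following lemmas restate them with the type's
  own \<open>+\<close>, \<open>*\<close>, \<open>0\<close> and \<open>1\<close>.\<close>

lemma smult_mem [simp, intro]: "x \<in> carrier A \<Longrightarrow> c \<odot> x \<in> carrier A"
  using smult_closed[of c x] by (simp add: ring_of_type_algebra_def)

lemma smult_add_left: "x \<in> carrier A \<Longrightarrow> (a + b) \<odot> x = a \<odot> x \<oplus> b \<odot> x"
  using smult_l_distr[of a b x] by (simp add: ring_of_type_algebra_def)

lemma smult_add_right:
  "\<lbrakk>x \<in> carrier A; y \<in> carrier A\<rbrakk> \<Longrightarrow> a \<odot> (x \<oplus> y) = a \<odot> x \<oplus> a \<odot> y"
  using smult_r_distr[of a x y] by (simp add: ring_of_type_algebra_def)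

lemma smult_smult [simp]: "x \<in> carrier A \<Longrightarrow> a \<odot> (b \<odot> x) = (a * b) \<odot> x"
  using smult_assoc1[of a b x] by (simp add: ring_of_type_algebra_def)

lemma one_smult [simp]: "x \<in> carrier A \<Longrightarrow> 1 \<odot> x = x"
  using smult_one[of x] by (simp add: ring_of_type_algebra_def)

lemma smult_zero_left [simp]: "x \<in> carrier A \<Longrightarrow> 0 \<odot> x = \<zero>"
  using smult_l_null[of x] by (simp add: ring_of_type_algebra_def)

lemma smult_zero_right [simp]: "c \<odot> \<zero> = \<zero>"
  using smult_r_null[of c] by (simp add: ring_of_type_algebra_def)

text \<open>Writing negatives as scalar multiples lets \<open>norm_smult\<close> handle them, and
  lets differences in \<open>B\<close> be evaluated pointwise.\<close>

lemma a_inv_eq_smult: "x \<in> carrier A \<Longrightarrow> \<ominus> x = (- 1) \<odot> x"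
  using smult_add_left[of x "- 1" 1] by (intro M.minus_equality) auto

lemma minus_eq_smult: "y \<in> carrier A \<Longrightarrow> x \<ominus> y = x \<oplus> (- 1) \<odot> y"
  by (simp add: M.minus_eq a_inv_eq_smult)

lemma vnorm_zero [simp]: "vnorm A \<zero> = 0"
  by (simp add: norm_eq_zero)

lemma vnorm_pos: "\<lbrakk>x \<in> carrier A; x \<noteq> \<zero>\<rbrakk> \<Longrightarrow> 0 < vnorm A x"
  using norm_nonneg[of x] norm_eq_zero[of x] by simp

lemma norm_dist_zero: "x \<in> carrier A \<Longrightarrow> norm_dist A x \<zero> = vnorm A x"
  by (simp add: norm_dist_def minus_eq_smult)

lemma vnorm_minus_commute:
  assumes "x \<in> carrier A" "y \<in> carrier A"
  shows "vnorm A (x \<ominus> y) = vnorm A (y \<ominus> x)"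
proof -
  have "y \<ominus> x = (- 1) \<odot> (x \<ominus> y)"
    using assms by (simp add: minus_eq_smult smult_add_right M.a_comm)
  then show ?thesis
    using assms by (simp add: norm_smult)
qed

lemma Metric_space_norm_dist: "Metric_space (carrier A) (norm_dist A)"
proof
  fix x y z
  show "0 \<le> norm_dist A x y"
    by (simp add: norm_dist_def norm_nonneg)
  show "norm_dist A x y = norm_dist A y x"
    by (simp add: norm_dist_def vnorm_minus_commute)
  assume x: "x \<in> carrier A" and y: "y \<in> carrier A"
  then have "x = (x \<ominus> y) \<oplus> y"
    by (simp add: M.minus_eq M.a_assoc M.l_neg)
  then have "x \<ominus> y = \<zero> \<longleftrightarrow> x = y"
    using y by (auto simp: M.minus_eq M.r_neg)
  then show "norm_dist A x y = 0 \<longleftrightarrow> x = y"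
    using x y by (simp add: norm_dist_def norm_eq_zero)
  assume z: "z \<in> carrier A"
  have "x \<ominus> z = (x \<ominus> y) \<oplus> (y \<ominus> z)"
    using x y z by (simp add: M.minus_eq M.a_assoc M.r_neg1)
  then show "norm_dist A x z \<le> norm_dist A x y + norm_dist A y z"
    using x y z norm_triangle[of "x \<ominus> y" "y \<ominus> z"] by (simp add: norm_dist_def)
qed

section \<open>The weight and the norm of B(X)\<close>

definition weight :: "'a \<Rightarrow> real" where
  "weight x = (if x = \<zero> then 1 else vnorm A x)"

lemma weight_pos: "x \<in> carrier A \<Longrightarrow> 0 < weight x"
  by (simp add: weight_def vnorm_pos)

lemma weight_zero [simp]: "weight \<zero> = 1"
  by (simp add: weight_def)

abbreviation B :: "('k, 'a \<Rightarrow> 'a) normed_algebra" where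
  "B \<equiv> bounded_maps A"

lemma bounded_maps_mapsto: "\<lbrakk>F \<in> carrier B; x \<in> carrier A\<rbrakk> \<Longrightarrow> F x \<in> carrier A"
  by (auto simp: bounded_maps_def)

lemma bounded_maps_eqI:
  assumes "F \<in> carrier B" "G \<in> carrier B" "\<And>x. x \<in> carrier A \<Longrightarrow> F x = G x"
  shows "F = G"
  using assms by (auto simp: bounded_maps_def intro: PiE_ext)

lemma quotients_le_iff:
  assumes "F \<in> carrier A \<rightarrow> carrier A"
  shows "(\<forall>q\<in>quotients A F. q \<le> b) \<longleftrightarrow>
    (\<forall>x\<in>carrier A - {\<zero>}. vnorm A (F x) \<le> b * weight x)"
  by (simp add: quotients_def weight_def pos_divide_le_eq vnorm_pos)

text \<open>The constant \<open>b\<close> bounds all quotients. The premise has the same form as the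
  criterion for \<open>vnorm B F \<le> b\<close>, so one pointwise estimate serves both
  purposes.\<close>

lemma bounded_maps_memI:
  assumes "F \<in> carrier A \<rightarrow>\<^sub>E carrier A"
    and "\<And>x. x \<in> carrier A \<Longrightarrow> vnorm A (F x) \<le> b * weight x"
  shows "F \<in> carrier B"
  using assms quotients_le_iff[of F b] by (auto simp: bounded_maps_def bdd_above_def)

text \<open>The supremum controls the points other than \<open>\<zero>\<close>. The second argument
  of the maximum is the inequality at \<open>\<zero>\<close>, where the weight is 1.\<close>

lemma vnorm_bounded_maps_le_iff:
  assumes "F \<in> carrier B"
  shows "vnorm B F \<le> b \<longleftrightarrow> (\<forall>x\<in>carrier A. vnorm A (F x) \<le> b * weight x)"
proof -
  have F: "F \<in> carrier A \<rightarrow> carrier A" "bdd_above (quotients A F)"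
    using assms by (auto simp: bounded_maps_def)
  \<comment> \<open>\<open>Sup\<close> is governed by its upper bounds only for nonempty sets;
    nontriviality supplies a nonzero point, hence a quotient.\<close>
  have ne: "quotients A F \<noteq> {}"
    using nontrivial M.zero_closed by (auto simp: quotients_def)
  have "vnorm B F \<le> b \<longleftrightarrow> (\<forall>q\<in>quotients A F. q \<le> b) \<and> vnorm A (F \<zero>) \<le> b"
    by (simp add: bounded_maps_def cSup_le_iff[OF ne F(2)])
  also have "\<dots> \<longleftrightarrow> (\<forall>x\<in>carrier A. vnorm A (F x) \<le> b * weight x)"
    unfolding quotients_le_iff[OF F(1)]
    by (metis DiffE DiffI M.zero_closed mult.right_neutral singletonD weight_zero)
  finally show ?thesis .
qed

lemma vnorm_apply_le:
  "\<lbrakk>F \<in> carrier B; x \<in> carrier A\<rbrakk> \<Longrightarrow> vnorm A (F x) \<le> vnorm B F * weight x"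
  using vnorm_bounded_maps_le_iff by blast

lemma vnorm_bounded_maps_nonneg: "F \<in> carrier B \<Longrightarrow> 0 \<le> vnorm B F"
  using vnorm_apply_le[of F \<zero>] norm_nonneg[of "F \<zero>"] bounded_maps_mapsto[of F \<zero>] by simp

section \<open>Pointwise operations and closure\<close>

lemma bounded_maps_ops:
  "\<zero>\<^bsub>B\<^esub> = (\<lambda>x\<in>carrier A. \<zero>)"
  "F \<oplus>\<^bsub>B\<^esub> G = (\<lambda>x\<in>carrier A. F x \<oplus> G x)"
  "c \<odot>\<^bsub>B\<^esub> F = (\<lambda>x\<in>carrier A. c \<odot> F x)"
  by (simp_all add: bounded_maps_def)

text \<open>At \<open>\<zero>\<close> the uniform formula multiplies by the scalar 1. That this
  changes nothing is known on the carrier, where membership of \<open>F\<close> and \<open>G\<close>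
  places the product.\<close>

lemma bounded_maps_mult:
  assumes "F \<in> carrier B" "G \<in> carrier B"
  shows "F \<otimes>\<^bsub>B\<^esub> G = (\<lambda>x\<in>carrier A. of_real (1 / weight x) \<odot> (F x \<otimes> G x))"
proof -
  have "F \<zero> \<otimes> G \<zero> \<in> carrier A"
    using assms by (simp add: bounded_maps_mapsto mult_closed)
  then show ?thesis
    by (auto simp: bounded_maps_def weight_def intro!: restrict_ext)
qed

lemma bounded_maps_apply [simp]:
  assumes "x \<in> carrier A"
  shows "\<zero>\<^bsub>B\<^esub> x = \<zero>" "(F \<oplus>\<^bsub>B\<^esub> G) x = F x \<oplus> G x" "(c \<odot>\<^bsub>B\<^esub> F) x = c \<odot> F x"
  using assms by (simp_all add: bounded_maps_ops)

lemma bounded_maps_mult_apply [simp]: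
  assumes "F \<in> carrier B" "G \<in> carrier B" "x \<in> carrier A"
  shows "(F \<otimes>\<^bsub>B\<^esub> G) x = of_real (1 / weight x) \<odot> (F x \<otimes> G x)"
  using assms by (simp add: bounded_maps_mult)

lemma bounded_maps_zero_closed: "\<zero>\<^bsub>B\<^esub> \<in> carrier B"
  by (rule bounded_maps_memI[where b = 0]) (auto simp: bounded_maps_ops)

text \<open>This estimate and its analogues for scalar multiples and products each give closure and,
  later, the matching norm inequality.\<close>

lemma vnorm_add_apply_le:
  assumes "F \<in> carrier B" "G \<in> carrier B" "x \<in> carrier A"
  shows "vnorm A ((F \<oplus>\<^bsub>B\<^esub> G) x) \<le> (vnorm B F + vnorm B G) * weight x"
  using assms norm_triangle[of "F x" "G x"] vnorm_apply_le[of F x] vnorm_apply_le[of G x]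
  by (simp add: bounded_maps_mapsto distrib_right)

lemma bounded_maps_add_closed:
  assumes "F \<in> carrier B" "G \<in> carrier B"
  shows "F \<oplus>\<^bsub>B\<^esub> G \<in> carrier B"
  by (rule bounded_maps_memI[OF _ vnorm_add_apply_le[OF assms]])
    (use assms in \<open>simp_all add: bounded_maps_ops PiE_iff extensional_def bounded_maps_mapsto\<close>)

lemma vnorm_smult_apply_le:
  assumes "F \<in> carrier B" "x \<in> carrier A"
  shows "vnorm A ((c \<odot>\<^bsub>B\<^esub> F) x) \<le> (norm c * vnorm B F) * weight x"
  using assms vnorm_apply_le[of F x]
  by (simp add: bounded_maps_mapsto norm_smult mult.assoc mult_left_mono)

lemma bounded_maps_smult_closed:
  assumes "F \<in> carrier B"
  shows "c \<odot>\<^bsub>B\<^esub> F \<in> carrier B"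
  by (rule bounded_maps_memI[OF _ vnorm_smult_apply_le[OF assms]])
    (use assms in \<open>simp_all add: bounded_maps_ops PiE_iff extensional_def bounded_maps_mapsto\<close>)

text \<open>Each factor contributes one \<open>weight x\<close>; the divisor in the product cancels
  one of the two.\<close>

lemma vnorm_mult_apply_le:
  assumes "F \<in> carrier B" "G \<in> carrier B" "x \<in> carrier A"
  shows "vnorm A ((F \<otimes>\<^bsub>B\<^esub> G) x) \<le> (vnorm B F * vnorm B G) * weight x"
proof -
  have "vnorm A (F x \<otimes> G x) \<le> vnorm A (F x) * vnorm A (G x)"
    using assms by (simp add: norm_mult bounded_maps_mapsto)
  also have "\<dots> \<le> (vnorm B F * weight x) * (vnorm B G * weight x)"
    using assms weight_pos[of x]
    by (intro mult_mono vnorm_apply_le)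
      (auto simp: bounded_maps_mapsto norm_nonneg vnorm_bounded_maps_nonneg)
  finally show ?thesis
    using assms weight_pos[of x]
    by (simp add: bounded_maps_mapsto mult_closed norm_smult norm_divide field_simps)
qed

lemma bounded_maps_mult_closed:
  assumes "F \<in> carrier B" "G \<in> carrier B"
  shows "F \<otimes>\<^bsub>B\<^esub> G \<in> carrier B"
  by (rule bounded_maps_memI[OF _ vnorm_mult_apply_le[OF assms]])
    (use assms in \<open>simp_all add: bounded_maps_mult PiE_iff extensional_def bounded_maps_mapsto
      mult_closed\<close>)

lemmas bounded_maps_closed =
  bounded_maps_zero_closed bounded_maps_add_closed bounded_maps_smult_closed
  bounded_maps_mult_closed

section \<open>The axioms of a normed algebra\<close>

lemma module_bounded_maps: "module (ring_of_type_algebra :: 'k ring) B"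
proof (rule moduleI)
  show "cring (ring_of_type_algebra :: 'k ring)" ..
  show "abelian_group B"
  proof (rule abelian_groupI)
    fix F assume F: "F \<in> carrier B"
    show "\<exists>G\<in>carrier B. G \<oplus>\<^bsub>B\<^esub> F = \<zero>\<^bsub>B\<^esub>"
    proof
      \<comment> \<open>The additive inverse is taken to be a scalar multiple, whose membership in
        \<open>B\<close> is already established.\<close>
      show "(- 1) \<odot>\<^bsub>B\<^esub> F \<oplus>\<^bsub>B\<^esub> F = \<zero>\<^bsub>B\<^esub>"
        using F by (intro bounded_maps_eqI)
          (auto simp: bounded_maps_closed bounded_maps_mapsto M.l_neg simp flip: a_inv_eq_smult)
    qed (use F in \<open>simp add: bounded_maps_closed\<close>)
  qed (auto intro!: bounded_maps_eqI
      simp: bounded_maps_closed bounded_maps_mapsto M.a_ac)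
qed (auto intro!: bounded_maps_eqI
    simp: ring_of_type_algebra_def bounded_maps_closed bounded_maps_mapsto
      smult_add_left smult_add_right)

text \<open>The identity map is the witness: its quotients are all 1, and it is nonzero because
  \<open>A\<close> is nontrivial.\<close>

lemma bounded_maps_nontrivial: "carrier B \<noteq> {\<zero>\<^bsub>B\<^esub>}"
proof -
  obtain y where y: "y \<in> carrier A" "y \<noteq> \<zero>"
    using nontrivial M.zero_closed by blast
  have "restrict (\<lambda>x. x) (carrier A) \<in> carrier B"
    by (rule bounded_maps_memI[where b = 1]) (auto simp: weight_def)
  moreover have "restrict (\<lambda>x. x) (carrier A) \<noteq> \<zero>\<^bsub>B\<^esub>"
  proof
    assume "restrict (\<lambda>x. x) (carrier A) = \<zero>\<^bsub>B\<^esub>"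
    from fun_cong[OF this, of y] y show False
      by simp
  qed
  ultimately show ?thesis
    by blast
qed

lemma vnorm_bounded_maps_smult:
  assumes "F \<in> carrier B"
  shows "vnorm B (c \<odot>\<^bsub>B\<^esub> F) = norm c * vnorm B F"
proof (rule antisym)
  have le: "vnorm B (c \<odot>\<^bsub>B\<^esub> F) \<le> norm c * vnorm B F" if "F \<in> carrier B" for c F
    using that by (simp add: vnorm_bounded_maps_le_iff bounded_maps_closed vnorm_smult_apply_le
        del: bounded_maps_apply)
  then show "vnorm B (c \<odot>\<^bsub>B\<^esub> F) \<le> norm c * vnorm B F"
    using assms .
  show "norm c * vnorm B F \<le> vnorm B (c \<odot>\<^bsub>B\<^esub> F)"
  proof (cases "c = 0")
    case True
    then show ?thesis
      using assms by (simp add: vnorm_bounded_maps_nonneg bounded_maps_closed)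
  next
    case False
    have "inverse c \<odot>\<^bsub>B\<^esub> (c \<odot>\<^bsub>B\<^esub> F) = F"
      using assms False
      by (intro bounded_maps_eqI) (auto simp: bounded_maps_closed bounded_maps_mapsto)
    with le[of "c \<odot>\<^bsub>B\<^esub> F" "inverse c"] show ?thesis
      using assms False by (simp add: bounded_maps_closed norm_divide field_simps)
  qed
qed

lemma vnorm_bounded_maps_eq_zero:
  assumes "F \<in> carrier B"
  shows "vnorm B F = 0 \<longleftrightarrow> F = \<zero>\<^bsub>B\<^esub>"
proof
  assume 0: "vnorm B F = 0"
  show "F = \<zero>\<^bsub>B\<^esub>"
  proof (intro bounded_maps_eqI assms bounded_maps_zero_closed)
    fix x assume x: "x \<in> carrier A"
    then have "vnorm A (F x) \<le> 0"
      using vnorm_apply_le[OF assms x] 0 by simp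
    then show "F x = \<zero>\<^bsub>B\<^esub> x"
      using norm_nonneg[of "F x"] norm_eq_zero[of "F x"] bounded_maps_mapsto[OF assms x] x by simp
  qed
next
  assume "F = \<zero>\<^bsub>B\<^esub>"
  moreover have "vnorm B \<zero>\<^bsub>B\<^esub> \<le> 0"
    by (simp add: vnorm_bounded_maps_le_iff bounded_maps_zero_closed)
  ultimately show "vnorm B F = 0"
    using vnorm_bounded_maps_nonneg[OF assms] by simp
qed

text \<open>The algebraic laws reduce to those of \<open>A\<close> at each point. For associativity,
  both bracketings carry the scalar \<open>1 / weight x\<close> twice.\<close>

lemma normed_algebra_bounded_maps: "normed_algebra B"
proof (intro normed_algebra.intro module_bounded_maps normed_algebra_axioms.intro)
  fix F G assume FG: "F \<in> carrier B" "G \<in> carrier B"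
  show "vnorm B (F \<oplus>\<^bsub>B\<^esub> G) \<le> vnorm B F + vnorm B G"
    using FG by (simp add: vnorm_bounded_maps_le_iff bounded_maps_closed vnorm_add_apply_le
        del: bounded_maps_apply)
  show "vnorm B (F \<otimes>\<^bsub>B\<^esub> G) \<le> vnorm B F * vnorm B G"
    using FG by (simp add: vnorm_bounded_maps_le_iff bounded_maps_closed vnorm_mult_apply_le
        del: bounded_maps_mult_apply)
qed (auto intro!: bounded_maps_eqI
    simp: bounded_maps_nontrivial vnorm_bounded_maps_nonneg vnorm_bounded_maps_eq_zero
      vnorm_bounded_maps_smult bounded_maps_closed bounded_maps_mapsto mult_closed mult_assoc
      mult_l_distr mult_r_distr mult_smult_left mult_smult_right smult_add_right mult.commute)

text \<open>Identifies the metric of \<open>B\<close> with weighted uniform distance, since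
  subtraction in \<open>B\<close> is pointwise.\<close>

lemma norm_dist_bounded_maps_le_iff:
  assumes "F \<in> carrier B" "G \<in> carrier B"
  shows "norm_dist B F G \<le> b \<longleftrightarrow>
    (\<forall>x\<in>carrier A. norm_dist A (F x) (G x) \<le> b * weight x)"
proof -
  interpret B: normed_algebra B
    by (rule normed_algebra_bounded_maps)
  have "F \<ominus>\<^bsub>B\<^esub> G = F \<oplus>\<^bsub>B\<^esub> (- 1) \<odot>\<^bsub>B\<^esub> G"
    using assms by (simp add: B.minus_eq_smult)
  then show ?thesis
    using assms by (simp add: norm_dist_def vnorm_bounded_maps_le_iff bounded_maps_mapsto
        minus_eq_smult bounded_maps_closed)
qed

section \<open>The unit\<close>

lemma algebra_unit_bounded_maps:
  assumes "algebra_unit A u"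
  shows "\<exists>e. algebra_unit B e \<and> vnorm B e = vnorm A u"
proof -
  have u: "u \<in> carrier A" "\<And>x. x \<in> carrier A \<Longrightarrow> u \<otimes> x = x" "\<And>x. x \<in> carrier A \<Longrightarrow> x \<otimes> u = x"
    using assms by (auto simp: algebra_unit_def)
  \<comment> \<open>The factor \<open>weight x\<close> cancels the divisor in the product. The map
    is built from \<open>u\<close> because the record field \<open>one\<close> of \<open>A\<close>
    is unconstrained.\<close>
  define e where "e = (\<lambda>x\<in>carrier A. of_real (weight x) \<odot> u)"
  have e_apply [simp]: "e x = of_real (weight x) \<odot> u" if "x \<in> carrier A" for x
    using that by (simp add: e_def)
  have norm_e: "vnorm A (e x) = vnorm A u * weight x" if "x \<in> carrier A" for x
    using that u(1) weight_pos[of x] by (simp add: norm_smult)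
  have e: "e \<in> carrier B"
    using u(1) norm_e by (intro bounded_maps_memI[where b = "vnorm A u"]) (auto simp: e_def)
  have "algebra_unit B e"
    unfolding algebra_unit_def
  proof (intro conjI ballI e)
    fix F assume F: "F \<in> carrier B"
    have w: "of_real (weight x) \<noteq> (0::'k)" if "x \<in> carrier A" for x
      using weight_pos[OF that] by simp
    show "e \<otimes>\<^bsub>B\<^esub> F = F" "F \<otimes>\<^bsub>B\<^esub> e = F"
      using F e u w by (auto intro!: bounded_maps_eqI
          simp: bounded_maps_closed bounded_maps_mapsto mult_smult_left mult_smult_right)
  qed
  moreover have "vnorm B e = vnorm A u"
  proof (rule antisym)
    show "vnorm B e \<le> vnorm A u"
      using e norm_e by (simp add: vnorm_bounded_maps_le_iff)
    show "vnorm A u \<le> vnorm B e"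
      using vnorm_apply_le[OF e M.zero_closed] u(1) by simp
  qed
  ultimately show ?thesis
    by blast
qed

end

section \<open>Completeness\<close>

text \<open>A Cauchy sequence in \<open>B\<close> is Cauchy at every point, so completeness of
  \<open>A\<close> gives a pointwise limit; the uniform Cauchy estimate then makes the convergence
  weighted uniform.\<close>

lemma (in banach_algebra) banach_algebra_bounded_maps: "banach_algebra (bounded_maps A)"
proof -
  interpret B: normed_algebra B
    by (rule normed_algebra_bounded_maps)
  interpret dA: Metric_space "carrier A" "norm_dist A"
    by (rule Metric_space_norm_dist)
  interpret dB: Metric_space "carrier B" "norm_dist B"
    by (rule B.Metric_space_norm_dist)
  have "\<exists>G. limitin dB.mtopology F G sequentially" if "dB.MCauchy F" for F
  proof -
    have F: "F n \<in> carrier B" for n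
      using that by (auto simp: dB.MCauchy_def)
    have F_mem: "F n x \<in> carrier A" if "x \<in> carrier A" for n x
      using F that by (rule bounded_maps_mapsto)
    have Cauchy: "\<exists>N. \<forall>n m. N \<le> n \<longrightarrow> N \<le> m \<longrightarrow> norm_dist B (F n) (F m) < \<epsilon>" if "0 < \<epsilon>" for \<epsilon>
      using \<open>dB.MCauchy F\<close> that by (simp add: dB.MCauchy_def)
    have dist_le: "norm_dist A (F n x) (F m x) \<le> norm_dist B (F n) (F m) * weight x"
      if "x \<in> carrier A" for n m x
      using norm_dist_bounded_maps_le_iff[OF F F, of n m] that by blast
    have "\<exists>l. limitin dA.mtopology (\<lambda>n. F n x) l sequentially" if x: "x \<in> carrier A" for x
    proof -
      have "dA.MCauchy (\<lambda>n. F n x)"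
        unfolding dA.MCauchy_def
      proof (intro conjI allI impI)
        show "range (\<lambda>n. F n x) \<subseteq> carrier A"
          using F_mem x by auto
        fix \<epsilon> :: real assume "0 < \<epsilon>"
        \<comment> \<open>At a fixed \<open>x\<close> the tolerance may depend on \<open>x\<close>,
          so the weight is absorbed into it.\<close>
        then have "0 < \<epsilon> / weight x"
          using weight_pos[OF x] by simp
        from Cauchy[OF this] obtain N
          where N: "\<And>n m. \<lbrakk>N \<le> n; N \<le> m\<rbrakk> \<Longrightarrow> norm_dist B (F n) (F m) < \<epsilon> / weight x"
          by blast
        have "norm_dist A (F n x) (F m x) < \<epsilon>" if "N \<le> n" "N \<le> m" for n m
        proof -
        have "norm_dist B (F n) (F m) * weight x < \<epsilon>"
          using N[OF that] weight_pos[OF x] by (simp only: pos_less_divide_eq)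
        with dist_le[OF x, of n m] show ?thesis
          by (rule le_less_trans)
      qed
        then show "\<exists>N. \<forall>n n'. N \<le> n \<longrightarrow> N \<le> n' \<longrightarrow> norm_dist A (F n x) (F n' x) < \<epsilon>"
          by blast
      qed
      then show ?thesis
        using complete by (simp add: dA.mcomplete_def)
    qed
    then obtain L
      where L: "\<And>x. x \<in> carrier A \<Longrightarrow> limitin dA.mtopology (\<lambda>n. F n x) (L x) sequentially"
      by metis
    \<comment> \<open>Restriction makes the limit extensional, as elements of \<open>B\<close> must
      be.\<close>
    define G where "G = restrict L (carrier A)"
    have G_mem: "G x \<in> carrier A" if "x \<in> carrier A" for x
      using L[OF that] that by (simp add: G_def dA.limit_metric_sequentially)
    \<comment> \<open>Here \<open>N\<close> is independent of \<open>x\<close>. Only the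
      intermediate index \<open>m\<close> below depends on \<open>x\<close>, and it disappears after
      the triangle inequality.\<close>
    have close: "\<exists>N. \<forall>n\<ge>N. \<forall>x\<in>carrier A. norm_dist A (F n x) (G x) \<le> \<epsilon> * weight x"
      if "0 < \<epsilon>" for \<epsilon>
    proof -
      have "0 < \<epsilon> / 2"
        using that by simp
      from Cauchy[OF this] obtain N
        where N: "\<And>n m. \<lbrakk>N \<le> n; N \<le> m\<rbrakk> \<Longrightarrow> norm_dist B (F n) (F m) < \<epsilon> / 2"
        by blast
      have "norm_dist A (F n x) (G x) \<le> \<epsilon> * weight x" if n: "N \<le> n" and x: "x \<in> carrier A" for n x
      proof -
        have "0 < \<epsilon> / 2 * weight x"
          using \<open>0 < \<epsilon>\<close> weight_pos[OF x] by simp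
        then obtain M where M: "\<And>m. M \<le> m \<Longrightarrow> norm_dist A (F m x) (G x) < \<epsilon> / 2 * weight x"
          using L[OF x] x unfolding dA.limit_metric_sequentially G_def by (metis restrict_apply')
        define m where "m = max M N"
        have "norm_dist A (F n x) (F m x) \<le> \<epsilon> / 2 * weight x"
          using norm_dist_bounded_maps_le_iff[OF F F, of n m "\<epsilon> / 2"] N[OF n, of m] x
          by (simp add: m_def)
        moreover have "norm_dist A (F m x) (G x) < \<epsilon> / 2 * weight x"
          by (rule M) (simp add: m_def)
        ultimately show ?thesis
          using dA.triangle[OF F_mem[OF x] F_mem[OF x] G_mem[OF x], of n m] by simp
      qed
      then show ?thesis
        by blast
    qed
    have G: "G \<in> carrier B"
    proof -
      \<comment> \<open>One term at weighted distance at most 1 from \<open>G\<close> suffices: it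
        gives the bound \<open>1 + vnorm B (F N)\<close> for \<open>G\<close>.\<close>
      obtain N where N: "\<And>x. x \<in> carrier A \<Longrightarrow> norm_dist A (F N x) (G x) \<le> 1 * weight x"
        using close[of 1] by (auto simp del: mult_1)
      show ?thesis
      proof (rule bounded_maps_memI)
        show "G \<in> carrier A \<rightarrow>\<^sub>E carrier A"
          using G_mem by (auto simp: G_def)
        fix x assume x: "x \<in> carrier A"
        have "vnorm A (G x) \<le> norm_dist A (F N x) (G x) + vnorm A (F N x)"
          using dA.triangle[OF G_mem[OF x] F_mem[OF x] M.zero_closed, of N]
            dA.commute[of "F N x" "G x"]
          by (simp add: norm_dist_zero G_mem F_mem x)
        also have "\<dots> \<le> 1 * weight x + vnorm B (F N) * weight x"
          by (intro add_mono N vnorm_apply_le F x)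
        finally show "vnorm A (G x) \<le> (1 + vnorm B (F N)) * weight x"
          by (simp only: distrib_right)
      qed
    qed
    have "\<exists>N. \<forall>n\<ge>N. norm_dist B (F n) G < \<epsilon>" if "0 < \<epsilon>" for \<epsilon>
    proof -
      \<comment> \<open>Pointwise bounds pass to the supremum only as weak inequalities; halving
        \<open>\<epsilon>\<close> restores strictness.\<close>
      obtain N where "\<forall>n\<ge>N. \<forall>x\<in>carrier A. norm_dist A (F n x) (G x) \<le> \<epsilon> / 2 * weight x"
        using close[of "\<epsilon> / 2"] half_gt_zero[OF \<open>0 < \<epsilon>\<close>] by blast
      then have "\<forall>n\<ge>N. norm_dist B (F n) G \<le> \<epsilon> / 2"
        by (simp only: norm_dist_bounded_maps_le_iff[OF F G])
      with that show ?thesis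
        by (intro exI[of _ N]) fastforce
    qed
    with F G show ?thesis
      by (auto simp: dB.limit_metric_sequentially)
  qed
  then have "dB.mcomplete"
    by (simp add: dB.mcomplete_def)
  then show ?thesis
    by (intro banach_algebra.intro normed_algebra_bounded_maps banach_algebra_axioms.intro)
qed

text \<open>The last conjunct covers the convention that a unit has norm 1; it follows because the
  constructed unit has the same norm as the given one.\<close>

theorem theorem2p7:
  fixes A :: "('k::real_normed_field, 'a) normed_algebra"
  assumes "normed_algebra A"
  shows "normed_algebra (bounded_maps A)
    \<and> (banach_algebra A \<longrightarrow> banach_algebra (bounded_maps A))
    \<and> ((\<exists>u. algebra_unit A u) \<longrightarrow> (\<exists>e. algebra_unit (bounded_maps A) e))
    \<and> ((\<exists>u. algebra_unit A u \<and> vnorm A u = 1) \<longrightarrow>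
         (\<exists>e. algebra_unit (bounded_maps A) e \<and> vnorm (bounded_maps A) e = 1))"
  using normed_algebra.normed_algebra_bounded_maps[OF assms]
    normed_algebra.algebra_unit_bounded_maps[OF assms]
    banach_algebra.banach_algebra_bounded_maps
  by metis

end
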